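(* Let $X$ be a centered, nondegenerate, infinitely divisible real random variable with finite variance $V>0$. Assume $\tau>0$ and let $x>0$. (i) $y_*(x)\ge I^{-1}(x)$. (ii) Let $t_v\in\mathcal{T}$, witnessed by $v\ge V$ with $c=c_*(v)$. Put $y=K_X'(t_v)$ and (here) $x=I(y)$. Then $$\sqrt{2vx}+c_*(v)\,x=y=I^{-1}(x),$$ so the infimum defining $y_*(x)$ is attained at this $v$ and equals the exact Chernoff deviation $I^{-1}(x)$. (iii) Consequently $y_*=I^{-1}$ on the set of levels $\{I(K_X'(t)):t\in\mathcal{T}\}$. (iv) Conversely, if $y_*(x)=I^{-1}(x)$ then $K_X$ has a Legendre maximiser at $y=I^{-1}(x)$ and it belongs to $\mathcal{T}$. Thus equality $y_*(x)=I^{-1}(x)$ holds exactly when a Legendre maximiser of $K_X$ at $y=I^{-1}(x)$ exists and lies in $\mathcal{T}$. Moreover, for every $x>0$ the infimum defining $y_*(x)$ is attained: $v\mapsto\sqrt{2vx}+c_*(v)x$ is finite and continuous on $[V,\infty)$ and tends to infinity as $v\to\infty$.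
   Context: Standing setting: $X$ is a centered, nondegenerate, infinitely divisible real random variable with variance $0<V=\mathrm{Var}(X)<\infty$, Gaussian variance $a\ge0$ and Lévy measure $\nu$ on $\mathbb{R}\setminus\{0\}$. For all real $t$, $K_X(t)=\log\mathbb{E}e^{tX}=\frac{at^2}{2}+\int_{\mathbb{R}\setminus\{0\}}(e^{tx}-1-tx)\,\nu(dx)\in[0,\infty]$. $\tau=\sup\{t>0:K_X(t)<\infty\}\in[0,\infty]$ (with $\sup\emptyset=0$). Convention: $1/0=\infty$. For $v>0$, $c\ge0$ let $g_{v,c}(t)=\frac{vt^2}{2(1-ct)}$, $0\le t<1/c$. The pair $(v,c)$ is feasible for $X$ if $K_X(t)\le g_{v,c}(t)$ for every $0\le t<1/c$ (for $c=0$: for all $t\ge0$). $c_*(v)=\inf\{c\ge0:(v,c)\text{ is feasible}\}\in[0,\infty]$, with $\inf\emptyset=\infty$. $y_*(x)=\inf_{v\ge V}\{\sqrt{2vx}+c_*(v)\,x\}$ for $x>0$. $I(y)=\sup_{t\in\mathbb{R}}\{ty-K_X(t)\}$ is the Cramér transform, and $I^{-1}(x)=\inf\{y>0:I(y)\ge x\}$ its generalized inverse. A Legendre maximiser of $K_X$ at $y$ is a point $t$ with $ty-K_X(t)=I(y)$ (the supremum is attained at $t$). The tangency set is $\mathcal{T}=\{t>0:\ \exists\,v\ge V\text{ with }c=c_*(v)<\infty,\ t<1/c,\ K_X(t)=g_{v,c}(t)\}$, which is a subset of $(0,\tau)$; such a $v$ is said to witness $t\in\mathcal{T}$. *)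

theory Defs
  imports "HOL-Probability.Probability"
begin

text \<open>
  A law is infinitely divisible if for every \<open>n \<ge> 1\<close> it is the law of a sum of \<open>n\<close> i.i.d. real
  random variables; these are taken to be the coordinates of the \<open>n\<close>-fold product of their law.
\<close>

definition infinitely_divisible :: "real measure \<Rightarrow> bool" where
  "infinitely_divisible \<mu> \<longleftrightarrow>
     (\<forall>n\<ge>1. \<exists>N. real_distribution N \<and>
        \<mu> = distr (Pi\<^sub>M {..<n::nat} (\<lambda>_. N)) borel (\<lambda>\<omega>. \<Sum>i<n. \<omega> i))"

text \<open>
  The function \<open>K\<^sub>X(t) = log E exp(tX)\<close>, with value \<open>\<infinity>\<close> when the expectation diverges.
\<close>

definition cgf :: "'a measure \<Rightarrow> ('a \<Rightarrow> real) \<Rightarrow> real \<Rightarrow> ereal" where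
  "cgf M X t =
     (if integrable M (\<lambda>\<omega>. exp (t * X \<omega>))
      then ereal (ln (prob_space.expectation M (\<lambda>\<omega>. exp (t * X \<omega>)))) else \<infinity>)"

text \<open>The derivative \<open>K\<^sub>X'\<close>; only meaningful where \<open>K\<^sub>X\<close> is finite in a neighbourhood.\<close>

definition cgf_deriv :: "'a measure \<Rightarrow> ('a \<Rightarrow> real) \<Rightarrow> real \<Rightarrow> real" where
  "cgf_deriv M X t = deriv (\<lambda>s. real_of_ereal (cgf M X s)) t"

text \<open>Inserting \<open>0\<close> implements \<open>sup \<emptyset> = 0\<close> (in \<^typ>\<open>ereal\<close> the empty supremum is \<open>-\<infinity>\<close>).\<close>

definition tau :: "'a measure \<Rightarrow> ('a \<Rightarrow> real) \<Rightarrow> ereal" where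
  "tau M X = Sup (insert 0 {ereal t | t. t > 0 \<and> cgf M X t < \<infinity>})"

definition subgamma :: "real \<Rightarrow> real \<Rightarrow> real \<Rightarrow> real" where
  "subgamma v c t = v * t\<^sup>2 / (2 * (1 - c * t))"

text \<open>
  The bound \<open>t < 1/c\<close> is taken in \<^typ>\<open>ereal\<close>, where \<open>1/0 = \<infinity>\<close>.
\<close>

definition feasible :: "'a measure \<Rightarrow> ('a \<Rightarrow> real) \<Rightarrow> real \<Rightarrow> real \<Rightarrow> bool" where
  "feasible M X v c \<longleftrightarrow>
     (\<forall>t\<ge>0. ereal t < 1 / ereal c \<longrightarrow> cgf M X t \<le> ereal (subgamma v c t))"

definition c_star :: "'a measure \<Rightarrow> ('a \<Rightarrow> real) \<Rightarrow> real \<Rightarrow> ereal" where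
  "c_star M X v = Inf {ereal c | c. c \<ge> 0 \<and> feasible M X v c}"

definition bound :: "'a measure \<Rightarrow> ('a \<Rightarrow> real) \<Rightarrow> real \<Rightarrow> real \<Rightarrow> ereal" where
  "bound M X x v = ereal (sqrt (2 * v * x)) + c_star M X v * ereal x"

definition y_star :: "'a measure \<Rightarrow> ('a \<Rightarrow> real) \<Rightarrow> real \<Rightarrow> ereal" where
  "y_star M X x = (INF v\<in>{prob_space.variance M X..}. bound M X x v)"

definition cramer :: "'a measure \<Rightarrow> ('a \<Rightarrow> real) \<Rightarrow> real \<Rightarrow> ereal" where
  "cramer M X y = (SUP t. ereal (t * y) - cgf M X t)"

definition cramer_inv :: "'a measure \<Rightarrow> ('a \<Rightarrow> real) \<Rightarrow> real \<Rightarrow> ereal" where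
  "cramer_inv M X x = Inf {ereal y | y. y > 0 \<and> cramer M X y \<ge> ereal x}"

definition legendre_maximiser :: "'a measure \<Rightarrow> ('a \<Rightarrow> real) \<Rightarrow> real \<Rightarrow> real \<Rightarrow> bool" where
  "legendre_maximiser M X y t \<longleftrightarrow> ereal (t * y) - cgf M X t = cramer M X y"

definition tangency_witness :: "'a measure \<Rightarrow> ('a \<Rightarrow> real) \<Rightarrow> real \<Rightarrow> real \<Rightarrow> bool" where
  "tangency_witness M X v t \<longleftrightarrow>
     t > 0 \<and> v \<ge> prob_space.variance M X \<and>
     (\<exists>c. c_star M X v = ereal c \<and> ereal t < 1 / ereal c \<and>
          cgf M X t = ereal (subgamma v c t))"

definition tangency_set :: "'a measure \<Rightarrow> ('a \<Rightarrow> real) \<Rightarrow> real set" where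
  "tangency_set M X = {t. \<exists>v. tangency_witness M X v t}"

end

theory Submission
  imports Defs
begin

text \<open>
  Write \<open>K\<close> for the logarithmic moment generating function, \<open>V\<close> for the variance, \<open>I\<close> for the
  Cramer transform and \<open>g\<close> for a sub-gamma function with parameters \<open>(v, c)\<close>. The level-\<open>x\<close>
  inverse of the convex conjugate of \<open>g\<close> is \<open>sqrt (2 * v * x) + c * x\<close>, and the conjugate is
  attained there at an explicit point \<open>t\<close> with \<open>c * t < 1\<close>. A majorant \<open>K \<le> g\<close> therefore gives, at
  \<open>y = sqrt (2 * v * x) + c * x\<close>, the chain \<open>x = t * y - g t \<le> t * y - K t \<le> I y\<close>; this is the
  inequality between \<open>y_star\<close> and the generalized inverse \<open>cramer_inv\<close>.

  Equality is a matter of contact between \<open>K\<close> and \<open>g\<close>. If \<open>K t = g t\<close>, then \<open>K\<close> is convex and lies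
  below a function differentiable at \<open>t\<close> that it touches there, so the tangent of \<open>g\<close> at \<open>t\<close>
  supports \<open>K\<close> (\<open>tangent_line\<close>). Hence \<open>K\<close> is differentiable at \<open>t\<close> with the slope \<open>y\<close> of \<open>g\<close>, the
  point \<open>t\<close> maximises \<open>s * y - K s\<close>, and \<open>I y\<close> equals the conjugate of \<open>g\<close> at \<open>y\<close>. No derivative
  is ever taken under the expectation. Conversely, let the infimum defining \<open>y_star\<close> be attained at
  \<open>v\<close> with value \<open>y = cramer_inv x\<close>. Since \<open>I y \<le> x\<close> by lower semicontinuity
  (\<open>cramer_at_cramer_inv_le\<close>), every inequality of the chain is an equality: \<open>t\<close> is a Legendre
  maximiser at which \<open>K\<close> touches \<open>g\<close>. It is the only maximiser, because \<open>K\<close> is strictly convex.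

  For the last equivalence one more fact is needed. A maximiser \<open>t\<close> at \<open>y = cramer_inv x\<close> lying in
  the tangency set gives exactness at the level \<open>I y\<close>, which must be shown to be \<open>x\<close> itself. The
  convex function \<open>I\<close> could only skip the levels between \<open>I y\<close> and \<open>x\<close> by jumping to infinity at
  \<open>y\<close>; but \<open>K\<close> is finite slightly to the right of a tangency point, which keeps \<open>I\<close> finite to the
  right of \<open>y\<close>.

  For the attainment of the infimum, clearing denominators turns feasibility into a family of
  inequalities that are jointly affine in \<open>(v, c)\<close> (\<open>feasible_iff\<close>). So the least feasible \<open>c\<close>
  exists and is a convex, decreasing, lower semicontinuous function of \<open>v\<close>, hence continuous up
  to the end point \<open>V\<close>. It is finite at \<open>V\<close> because \<open>K t \<le> V * t\<^sup>2 / 2 + O(t\<^sup>3)\<close> as \<open>t\<close> decreases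
  to \<open>0\<close>.
\<close>

section \<open>Exponential inequalities\<close>

lemma exp_le_quadratic_plus_cube:
  fixes u :: real
  shows "exp u \<le> 1 + u + u\<^sup>2 / 2 + max 0 u ^ 3 * exp u / 6"
proof -
  obtain r where r: "\<bar>r\<bar> \<le> \<bar>u\<bar>" "exp u = (\<Sum>m<3. u ^ m / fact m) + exp r / fact 3 * u ^ 3"
    using Maclaurin_exp_le by blast
  have e: "exp u = 1 + u + u\<^sup>2 / 2 + exp r / 6 * u ^ 3"
    using r(2) by (simp add: eval_nat_numeral)
  show ?thesis
  proof (cases "u \<le> 0")
    case True
    then have "u ^ 3 \<le> 0" by (simp add: power_le_zero_eq)
    then have "exp r / 6 * u ^ 3 \<le> 0" by (simp add: mult_nonneg_nonpos)
    with e True show ?thesis by simp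
  next
    case False
    then have "exp r * u ^ 3 \<le> exp u * u ^ 3"
      using r(1) by (intro mult_right_mono) auto
    with e False show ?thesis by (simp add: mult.commute)
  qed
qed

lemma cube_le_exp:
  fixes u :: real
  assumes "0 \<le> u"
  shows "u ^ 3 \<le> 27 * exp u"
proof -
  have "u / 3 \<le> exp (u / 3)"
    using exp_ge_add_one_self[of "u / 3"] by linarith
  then have "(u / 3) ^ 3 \<le> exp (u / 3) ^ 3"
    using assms by (intro power_mono) auto
  also have "exp (u / 3) ^ 3 = exp u"
    by (simp flip: exp_of_nat_mult)
  finally show ?thesis by (simp add: power_divide)
qed

text \<open>
  For negative \<open>z\<close> the quadratic Taylor polynomial already majorises the exponential, so the left
  tail contributes nothing to the remainder. For positive \<open>z\<close> half of the exponent \<open>t\<^sub>0 * z\<close>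
  dominates \<open>exp (t * z)\<close> and the other half absorbs the factor \<open>z ^ 3\<close>.
\<close>

lemma exp_scaled_le_quadratic_plus_cubic:
  fixes z t t\<^sub>0 :: real
  assumes "0 \<le> t" "t \<le> t\<^sub>0 / 2" "0 < t\<^sub>0"
  shows "exp (t * z) \<le> 1 + t * z + t\<^sup>2 / 2 * z\<^sup>2 + t ^ 3 * (36 / t\<^sub>0 ^ 3 * exp (t\<^sub>0 * z))"
proof -
  have "max 0 (t * z) ^ 3 * exp (t * z) / 6 \<le> t ^ 3 * (36 / t\<^sub>0 ^ 3 * exp (t\<^sub>0 * z))"
  proof (cases "z \<le> 0")
    case True
    then have "max 0 (t * z) = 0"
      using assms mult_nonneg_nonpos[of t z] by simp
    then show ?thesis using assms by simp
  next
    case False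
    have "t * z \<le> t\<^sub>0 / 2 * z"
      using False assms by (intro mult_right_mono) auto
    then have e: "exp (t * z) \<le> exp (t\<^sub>0 / 2 * z)" by simp
    have "(t\<^sub>0 / 2 * z) ^ 3 \<le> 27 * exp (t\<^sub>0 / 2 * z)"
      using False assms by (intro cube_le_exp) auto
    then have "z ^ 3 \<le> 216 / t\<^sub>0 ^ 3 * exp (t\<^sub>0 / 2 * z)"
      using assms by (simp add: field_simps power_mult_distrib power_divide)
    then have "z ^ 3 * exp (t * z) \<le> 216 / t\<^sub>0 ^ 3 * exp (t\<^sub>0 / 2 * z) * exp (t\<^sub>0 / 2 * z)"
      using e assms by (intro mult_mono) auto
    also have "\<dots> = 216 / t\<^sub>0 ^ 3 * exp (t\<^sub>0 * z)"
      by (simp flip: exp_add)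
    finally have "t ^ 3 * (z ^ 3 * exp (t * z)) \<le> t ^ 3 * (216 / t\<^sub>0 ^ 3 * exp (t\<^sub>0 * z))"
      using assms by (intro mult_left_mono) auto
    moreover have "max 0 (t * z) = t * z" using False assms by simp
    ultimately show ?thesis by (simp add: power_mult_distrib mult_ac)
  qed
  then show ?thesis
    using exp_le_quadratic_plus_cube[of "t * z"] by (simp add: power_mult_distrib)
qed

section \<open>Sub-gamma functions and their conjugates\<close>

text \<open>The derivative of \<^term>\<open>subgamma v c\<close>.\<close>

definition subgamma_slope :: "real \<Rightarrow> real \<Rightarrow> real \<Rightarrow> real" where
  "subgamma_slope v c t = v * t * (2 - c * t) / (2 * (1 - c * t)\<^sup>2)"

lemma subgamma_has_derivative:
  assumes "c * t < 1"
  shows "(subgamma v c has_real_derivative subgamma_slope v c t) (at t)"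
proof -
  have "(subgamma v c has_real_derivative
      ((v * (2 * t)) * (2 * (1 - c * t)) - v * t\<^sup>2 * (2 * - c)) / (2 * (1 - c * t))\<^sup>2) (at t)"
    unfolding subgamma_def[abs_def] using assms
    by (auto intro!: derivative_eq_intros simp: power2_eq_square)
  also have "((v * (2 * t)) * (2 * (1 - c * t)) - v * t\<^sup>2 * (2 * - c)) / (2 * (1 - c * t))\<^sup>2
      = (2 * (v * t * (2 - c * t))) / (2 * (2 * (1 - c * t)\<^sup>2))"
    by (rule arg_cong2[where f = "(/)"]) (simp_all add: algebra_simps power2_eq_square)
  also have "\<dots> = subgamma_slope v c t"
    unfolding subgamma_slope_def by (rule mult_divide_mult_cancel_left) simp
  finally show ?thesis .
qed

lemma subgamma_conjugate:
  assumes "c * t < 1"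
  shows "t * subgamma_slope v c t - subgamma v c t = v * t\<^sup>2 / (2 * (1 - c * t)\<^sup>2)"
proof -
  define q where "q = 1 - c * t"
  have q: "q > 0" "2 - c * t = 1 + q" using assms by (auto simp: q_def)
  then show ?thesis
    unfolding subgamma_slope_def subgamma_def q(2) q_def[symmetric]
    by (simp add: field_simps power2_eq_square)
qed

text \<open>
  The tangent of slope \<open>y\<close> at \<open>t\<close> identifies \<open>x\<close> as the conjugate at \<open>y\<close>. The formula thus inverts
  the conjugate along the curve of slopes, which is why the quantity minimised in \<open>y_star\<close> has the
  form it has.
\<close>

lemma subgamma_inverse_conjugate:
  assumes "c * t < 1" "0 < t" "0 < v"
  defines "x \<equiv> t * subgamma_slope v c t - subgamma v c t"
  shows "sqrt (2 * v * x) + c * x = subgamma_slope v c t"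
proof -
  define q where "q = 1 - c * t"
  have q: "q > 0" "c * t = 1 - q" "2 - c * t = 1 + q" using assms by (auto simp: q_def)
  have x: "x = v * t\<^sup>2 / (2 * q\<^sup>2)"
    unfolding x_def q_def using assms(1) by (rule subgamma_conjugate)
  have "2 * v * x = (v * t / q)\<^sup>2"
    unfolding x using q by (simp add: power2_eq_square)
  then have s: "sqrt (2 * v * x) = v * t / q"
    using q assms by simp
  have "c * x = v * t * (c * t) / (2 * q\<^sup>2)"
    unfolding x by (simp add: power2_eq_square)
  then have cx: "c * x = v * t * (1 - q) / (2 * q\<^sup>2)" unfolding q(2) .
  show ?thesis
    unfolding s cx subgamma_slope_def q(3) q_def[symmetric] using q(1)
    by (simp add: field_simps power2_eq_square)
qed

text \<open>
  The same inversion started from the level \<open>x\<close>. Solving \<open>x = v * t\<^sup>2 / (2 * (1 - c * t)\<^sup>2)\<close> for \<open>t\<close>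
  gives \<open>t / (1 - c * t) = s\<close> with \<open>s = sqrt (2 * x / v)\<close>, whence the witness \<open>t = s / (1 + c * s)\<close>.
\<close>

lemma subgamma_conjugate_attained:
  assumes "0 \<le> c" "0 < v" "0 < x"
  obtains t where "0 < t" "c * t < 1" "t * (sqrt (2 * v * x) + c * x) - subgamma v c t = x"
proof
  define s where "s = sqrt (2 * x / v)"
  define t where "t = s / (1 + c * s)"
  have s: "s > 0" "v * s\<^sup>2 = 2 * x" using assms by (auto simp: s_def)
  have "(v * s)\<^sup>2 = v * (v * s\<^sup>2)" by (simp add: power2_eq_square)
  then have "2 * v * x = (v * s)\<^sup>2" using s(2) by simp
  then have r: "sqrt (2 * v * x) = v * s" using s assms by simp
  have d: "1 + c * s > 0" using s assms by (simp add: add_pos_nonneg)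
  show "0 < t" "c * t < 1" using s d assms by (auto simp: t_def field_simps)
  have q: "1 - c * t = 1 / (1 + c * s)" using d by (simp add: t_def field_simps)
  have "subgamma v c t = (v * s\<^sup>2) / (2 * (1 + c * s))"
    unfolding subgamma_def q unfolding t_def using d
    by (simp add: power_divide power2_eq_square)
  also have "\<dots> = x / (1 + c * s)"
    unfolding s(2) by (rule mult_divide_mult_cancel_left) simp
  finally have g: "subgamma v c t = x / (1 + c * s)" .
  have "t * (v * s + c * x) = (v * s\<^sup>2 + c * s * x) / (1 + c * s)"
    using d by (simp add: t_def field_simps power2_eq_square)
  also have "\<dots> = (2 * x + c * s * x) / (1 + c * s)" using s by simp
  finally have "t * (v * s + c * x) - subgamma v c t = (x * (1 + c * s)) / (1 + c * s)"
    unfolding g by (simp add: diff_divide_distrib[symmetric] algebra_simps)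
  also have "\<dots> = x" using d by simp
  finally show "t * (sqrt (2 * v * x) + c * x) - subgamma v c t = x"
    by (simp add: r)
qed

lemma less_inverse_ereal_iff:
  assumes "0 \<le> c" "0 \<le> t"
  shows "ereal t < 1 / ereal c \<longleftrightarrow> c * t < 1"
proof (cases "c = 0")
  case True
  then show ?thesis by (simp add: divide_ereal_def)
next
  case False
  with assms have "c > 0" by simp
  then have "1 / ereal c = ereal (1 / c)" by (simp add: one_ereal_def)
  then show ?thesis using \<open>c > 0\<close> by (simp add: field_simps)
qed

section \<open>Convexity of the logarithmic moment generating function\<close>

locale centered_variable = prob_space M for M :: "'a measure" +
  fixes X :: "'a \<Rightarrow> real"
  assumes measurable_X [measurable]: "X \<in> borel_measurable M"
    and integrable_square: "integrable M (\<lambda>\<omega>. (X \<omega>)\<^sup>2)"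
    and centered: "expectation X = 0"
    and variance_pos: "variance X > 0"
begin

definition exp_integrable :: "real \<Rightarrow> bool" where
  "exp_integrable t \<longleftrightarrow> integrable M (\<lambda>\<omega>. exp (t * X \<omega>))"

definition log_mgf :: "real \<Rightarrow> real" where
  "log_mgf t = ln (expectation (\<lambda>\<omega>. exp (t * X \<omega>)))"

lemma cgf_eq: "cgf M X t = (if exp_integrable t then ereal (log_mgf t) else \<infinity>)"
  by (simp add: cgf_def exp_integrable_def log_mgf_def)

lemma integrable_X: "integrable M X"
  using square_integrable_imp_integrable[OF measurable_X] integrable_square by simp

lemma mgf_ge_1:
  assumes "exp_integrable t"
  shows "1 \<le> expectation (\<lambda>\<omega>. exp (t * X \<omega>))"
proof -
  have "expectation (\<lambda>\<omega>. 1 + t * X \<omega>) \<le> expectation (\<lambda>\<omega>. exp (t * X \<omega>))"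
    using assms integrable_X unfolding exp_integrable_def
    by (intro integral_mono) (auto intro!: exp_ge_add_one_self)
  then show ?thesis
    using integrable_X by (simp add: centered prob_space)
qed

lemma exp_log_mgf:
  assumes "exp_integrable t"
  shows "expectation (\<lambda>\<omega>. exp (t * X \<omega>)) = exp (log_mgf t)"
  using mgf_ge_1[OF assms] by (simp add: log_mgf_def)

lemma log_mgf_nonneg: "exp_integrable t \<Longrightarrow> 0 \<le> log_mgf t"
  using mgf_ge_1 by (simp add: log_mgf_def)

lemma exp_integrable_0: "exp_integrable 0" and log_mgf_0: "log_mgf 0 = 0"
  by (simp_all add: exp_integrable_def log_mgf_def prob_space)

text \<open>
  The exponential tilts are probability densities. Convexity and strict convexity of \<open>log_mgf\<close> both
  come from comparing two of them.
\<close>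

lemma tilt_integrable:
  assumes "exp_integrable t"
  shows "integrable M (\<lambda>\<omega>. exp (t * X \<omega> - log_mgf t))"
    and "expectation (\<lambda>\<omega>. exp (t * X \<omega> - log_mgf t)) = 1"
  using assms exp_log_mgf[OF assms] by (simp_all add: exp_diff exp_integrable_def)

text \<open>
  By convexity of \<open>exp\<close>, the weighted geometric mean of two tilts is at most their arithmetic mean,
  whose expectation is \<open>1\<close>. This gives integrability and the inequality at once.
\<close>

lemma log_mgf_convex:
  assumes "exp_integrable s" "exp_integrable t" "0 \<le> l" "l \<le> 1"
  shows "exp_integrable ((1 - l) * s + l * t)" (is "exp_integrable ?m")
    and "log_mgf ((1 - l) * s + l * t) \<le> (1 - l) * log_mgf s + l * log_mgf t" (is "_ \<le> ?k")
proof -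
  let ?W = "\<lambda>\<omega>. (1 - l) * exp (s * X \<omega> - log_mgf s) + l * exp (t * X \<omega> - log_mgf t)"
  have le: "exp (?m * X \<omega> - ?k) \<le> ?W \<omega>" for \<omega>
    using convex_onD[OF exp_convex, of l "s * X \<omega> - log_mgf s" "t * X \<omega> - log_mgf t"] assms
    by (simp add: algebra_simps)
  have W: "integrable M ?W" "expectation ?W = 1"
    using tilt_integrable[OF assms(1)] tilt_integrable[OF assms(2)] by simp_all
  have i: "integrable M (\<lambda>\<omega>. exp (?m * X \<omega> - ?k))"
    by (rule Bochner_Integration.integrable_bound[OF W(1)]) (auto intro: order_trans[OF le abs_ge_self])
  have "integrable M (\<lambda>\<omega>. exp ?k * exp (?m * X \<omega> - ?k))"
    using i by simp
  then show m: "exp_integrable ?m" by (simp add: exp_integrable_def flip: exp_add)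
  have "expectation (\<lambda>\<omega>. exp (?m * X \<omega> - ?k)) \<le> expectation ?W"
    by (intro integral_mono i W(1) le)
  also note W(2)
  finally have "expectation (\<lambda>\<omega>. exp (?m * X \<omega> - ?k)) \<le> 1" .
  then have "exp (log_mgf ?m) \<le> exp ?k"
    using exp_log_mgf[OF m] by (simp add: exp_diff)
  then show "log_mgf ?m \<le> ?k" by simp
qed

text \<open>
  The function \<open>?G\<close> is the squared difference of the square roots of two tilts. Its expectation, a
  Hellinger distance, vanishes only if the tilts agree almost surely; this would force \<open>X\<close> to be
  constant, contrary to its positive variance.
\<close>

lemma log_mgf_strict_midpoint:
  assumes "exp_integrable s" "exp_integrable t" "s \<noteq> t"
  shows "log_mgf ((s + t) / 2) < (log_mgf s + log_mgf t) / 2"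
proof -
  let ?m = "(s + t) / 2" and ?k = "(log_mgf s + log_mgf t) / 2"
  let ?Y = "\<lambda>u \<omega>. u * X \<omega> - log_mgf u"
  let ?G = "\<lambda>\<omega>. (exp (?Y s \<omega> / 2) - exp (?Y t \<omega> / 2))\<^sup>2"
  have m: "exp_integrable ?m"
    using log_mgf_convex(1)[OF assms(1,2), of "1/2"] by (simp add: field_simps)
  have eq: "?G \<omega> = exp (?Y s \<omega>) + exp (?Y t \<omega>) - 2 * exp (- ?k) * exp (?m * X \<omega>)" for \<omega>
  proof -
    have "exp (?Y s \<omega> / 2) * exp (?Y t \<omega> / 2) = exp (- ?k) * exp (?m * X \<omega>)"
      unfolding exp_add[symmetric] by (simp add: field_simps)
    moreover have "exp z = (exp (z / 2))\<^sup>2" for z :: real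
      using exp_double[of "z / 2"] by simp
    note this[of "?Y s \<omega>"] this[of "?Y t \<omega>"]
    ultimately show ?thesis by (simp add: power2_diff)
  qed
  have i: "integrable M ?G"
    unfolding eq using tilt_integrable(1)[OF assms(1)] tilt_integrable(1)[OF assms(2)] m
    by (simp add: exp_integrable_def)
  have e: "expectation ?G = 2 - 2 * exp (- ?k) * exp (log_mgf ?m)"
    unfolding eq using tilt_integrable[OF assms(1)] tilt_integrable[OF assms(2)] m exp_log_mgf[OF m]
    by (simp add: exp_integrable_def)
  have "expectation ?G \<noteq> 0"
  proof
    assume "expectation ?G = 0"
    then have "AE \<omega> in M. ?G \<omega> = 0"
      using i by (subst (asm) integral_nonneg_eq_0_iff_AE) auto
    then have "AE \<omega> in M. X \<omega> = (log_mgf s - log_mgf t) / (s - t)"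
      by eventually_elim (use assms(3) in \<open>simp add: field_simps\<close>)
    then obtain b where b: "AE \<omega> in M. X \<omega> = b" by blast
    then have "expectation X = expectation (\<lambda>_. b)"
      by (intro integral_cong_AE) auto
    then have "b = 0" by (simp add: centered prob_space)
    then have "expectation (\<lambda>\<omega>. (X \<omega> - expectation X)\<^sup>2) = expectation (\<lambda>_. 0)"
      using b by (intro integral_cong_AE) (auto simp: centered)
    then show False using variance_pos by simp
  qed
  moreover have "expectation ?G \<ge> 0" by (rule Bochner_Integration.integral_nonneg) simp
  ultimately have "exp (- ?k) * exp (log_mgf ?m) < 1" using e by linarith
  then show ?thesis by (simp flip: exp_add)
qed

section \<open>The Cramer transform and its generalized inverse\<close>

lemma ereal_le_cramer: "exp_integrable t \<Longrightarrow> ereal (t * y - log_mgf t) \<le> cramer M X y"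
  unfolding cramer_def by (rule SUP_upper2[of t]) (auto simp: cgf_eq)

lemma cramer_le_iff:
  "cramer M X y \<le> ereal x \<longleftrightarrow> (\<forall>t. exp_integrable t \<longrightarrow> t * y - log_mgf t \<le> x)"
  unfolding cramer_def SUP_le_iff by (auto simp: cgf_eq)

lemma cramer_nonneg: "0 \<le> cramer M X y"
  using ereal_le_cramer[OF exp_integrable_0, of y] by (simp add: log_mgf_0 zero_ereal_def)

text \<open>
  For \<open>y \<ge> 0\<close> the points \<open>t \<le> 0\<close> contribute nothing positive to the supremum, because \<open>log_mgf\<close> is
  nonnegative.
\<close>

lemma cramer_mono:
  assumes "0 \<le> y" "y \<le> z"
  shows "cramer M X y \<le> cramer M X z"
proof (cases "cramer M X z")
  case (real r)
  then have *: "\<forall>t. exp_integrable t \<longrightarrow> t * z - log_mgf t \<le> r"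
    using cramer_le_iff[of z r] by simp
  have r: "0 \<le> r" using cramer_nonneg[of z] real by (simp add: zero_ereal_def)
  have "t * y - log_mgf t \<le> r" if t: "exp_integrable t" for t
  proof (cases "t \<le> 0")
    case True
    then show ?thesis
      using log_mgf_nonneg[OF t] mult_nonpos_nonneg[OF True assms(1)] r by linarith
  next
    case False
    then have "t * y \<le> t * z" using assms by simp
    then show ?thesis using *[rule_format, OF t] by linarith
  qed
  then show ?thesis unfolding real cramer_le_iff by blast
qed (use cramer_nonneg[of z] in auto)

lemma cramer_convex:
  assumes "cramer M X y \<le> ereal a" "cramer M X z \<le> ereal b" "0 \<le> l" "l \<le> 1"
  shows "cramer M X ((1 - l) * y + l * z) \<le> ereal ((1 - l) * a + l * b)"
  unfolding cramer_le_iff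
proof (intro allI impI)
  fix t assume t: "exp_integrable t"
  have "(1 - l) * (t * y - log_mgf t) + l * (t * z - log_mgf t) \<le> (1 - l) * a + l * b"
    using assms t by (intro add_mono mult_left_mono) (auto simp: cramer_le_iff)
  then show "t * ((1 - l) * y + l * z) - log_mgf t \<le> (1 - l) * a + l * b"
    by (simp add: algebra_simps)
qed

lemma cramer_inv_le: "0 < y \<Longrightarrow> ereal x \<le> cramer M X y \<Longrightarrow> cramer_inv M X x \<le> ereal y"
  unfolding cramer_inv_def by (intro Inf_lower) auto

text \<open>
  The transform is convex and vanishes at \<open>0\<close>, so it lies below its chord from \<open>0\<close> to \<open>y\<close> and
  cannot reach the positive level \<open>x\<close> before \<open>y\<close>.
\<close>

lemma cramer_inv_cramer:
  assumes "0 < y" "0 < x" "cramer M X y = ereal x"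
  shows "cramer_inv M X x = ereal y"
proof (rule antisym)
  show "cramer_inv M X x \<le> ereal y"
    using assms by (intro cramer_inv_le) auto
  show "ereal y \<le> cramer_inv M X x"
    unfolding cramer_inv_def
  proof (rule Inf_greatest, clarsimp)
    fix z assume z: "0 < z" "ereal x \<le> cramer M X z"
    show "y \<le> z"
    proof (rule ccontr)
      assume "\<not> y \<le> z"
      define l where "l = z / y"
      have l: "0 \<le> l" "l < 1" using z assms \<open>\<not> y \<le> z\<close> by (auto simp: l_def)
      have "cramer M X 0 \<le> ereal 0"
        using log_mgf_nonneg by (simp add: cramer_le_iff)
      from cramer_convex[OF this, of y x l] assms l
      have "cramer M X z \<le> ereal (l * x)" by (simp add: l_def)
      also have "\<dots> < ereal x" using l assms by simp
      finally show False using z by simp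
    qed
  qed
qed

text \<open>
  This is lower semicontinuity at the generalized inverse: a line \<open>t * y - log_mgf t\<close> that exceeds
  \<open>x\<close> at \<open>y\<close> crosses the level \<open>x\<close> at some smaller positive point.
\<close>

lemma cramer_at_cramer_inv_le:
  assumes "0 < x" "cramer_inv M X x = ereal y"
  shows "cramer M X y \<le> ereal x"
  unfolding cramer_le_iff
proof (intro allI impI)
  fix t assume t: "exp_integrable t"
  have "ereal 0 \<le> cramer_inv M X x" unfolding cramer_inv_def
    by (intro Inf_greatest) auto
  then have y: "0 \<le> y" using assms by simp
  show "t * y - log_mgf t \<le> x"
  proof (rule ccontr)
    assume "\<not> t * y - log_mgf t \<le> x"
    then have *: "x + log_mgf t < t * y" by simp
    have p: "0 < x + log_mgf t" using log_mgf_nonneg[OF t] assms by simp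
    have "0 < t * y" using * p by linarith
    then have tp: "0 < t" using y by (simp add: zero_less_mult_iff)
    define z where "z = (x + log_mgf t) / t"
    have z: "0 < z" "z < y" "t * z - log_mgf t = x"
      using tp p * by (auto simp: z_def field_simps)
    from ereal_le_cramer[OF t, of z] z have "ereal x \<le> cramer M X z" by simp
    from cramer_inv_le[OF z(1) this] assms z show False by simp
  qed
qed

lemma legendre_maximiserI:
  assumes "exp_integrable t" "\<And>s. exp_integrable s \<Longrightarrow> s * y - log_mgf s \<le> t * y - log_mgf t"
  shows "cramer M X y = ereal (t * y - log_mgf t)"
  using assms by (intro antisym ereal_le_cramer) (auto simp: cramer_le_iff)

lemma legendre_maximiserD:
  assumes "legendre_maximiser M X y t"
  shows "exp_integrable t" "cramer M X y = ereal (t * y - log_mgf t)"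
    "exp_integrable s \<Longrightarrow> s * y - log_mgf s \<le> t * y - log_mgf t"
proof -
  show t: "exp_integrable t"
  proof (rule ccontr)
    assume "\<not> exp_integrable t"
    with assms[unfolded legendre_maximiser_def, symmetric] have "cramer M X y = - \<infinity>"
      by (simp add: cgf_eq)
    with cramer_nonneg[of y] show False by simp
  qed
  show c: "cramer M X y = ereal (t * y - log_mgf t)"
    using assms t by (simp add: legendre_maximiser_def cgf_eq)
  show "exp_integrable s \<Longrightarrow> s * y - log_mgf s \<le> t * y - log_mgf t"
    using ereal_le_cramer[of s y] c by simp
qed

lemma legendre_maximiser_unique:
  assumes "legendre_maximiser M X y s" "legendre_maximiser M X y t"
  shows "s = t"
proof (rule ccontr)
  assume "s \<noteq> t"
  note S = legendre_maximiserD[OF assms(1)] and T = legendre_maximiserD[OF assms(2)]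
  have m: "exp_integrable ((s + t) / 2)"
    using log_mgf_convex(1)[OF S(1) T(1), of "1/2"] by (simp add: field_simps)
  have "(s + t) / 2 * y - log_mgf ((s + t) / 2) \<le> s * y - log_mgf s"
    by (rule S(3)[OF m])
  moreover have "(s + t) / 2 * y - log_mgf ((s + t) / 2) \<le> t * y - log_mgf t"
    by (rule T(3)[OF m])
  moreover note log_mgf_strict_midpoint[OF S(1) T(1) \<open>s \<noteq> t\<close>]
  ultimately show False by (simp add: field_simps)
qed

text \<open>
  By uniqueness of the maximiser the chord of \<open>log_mgf\<close> from \<open>t\<close> to \<open>u\<close> has a slope \<open>z\<close> larger than
  \<open>y\<close>. Beyond \<open>u\<close> convexity keeps \<open>log_mgf\<close> above the line of slope \<open>z\<close> through the end points of
  the chord, and up to \<open>u\<close> nonnegativity of \<open>log_mgf\<close> suffices.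
\<close>

lemma cramer_finite_right_of_maximiser:
  assumes "legendre_maximiser M X y t" "0 \<le> y" "0 \<le> t" "t < u" "exp_integrable u"
  shows "\<exists>z>y. \<exists>b. cramer M X z \<le> ereal b"
proof -
  note T = legendre_maximiserD[OF assms(1)]
  define z where "z = (log_mgf u - log_mgf t) / (u - t)"
  have ne: "u * y - log_mgf u \<noteq> t * y - log_mgf t"
  proof
    assume "u * y - log_mgf u = t * y - log_mgf t"
    then have "legendre_maximiser M X y u"
      using T(2) assms(5) by (simp add: legendre_maximiser_def cgf_eq)
    then show False using legendre_maximiser_unique[OF assms(1)] assms by blast
  qed
  with T(3)[OF assms(5)] have "u * y - log_mgf u < t * y - log_mgf t" by simp
  then have zy: "y < z" using assms by (simp add: z_def field_simps)
  have chord: "log_mgf u - log_mgf t = z * (u - t)" using assms by (simp add: z_def)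
  have "s * z - log_mgf s \<le> max (u * z) (t * z - log_mgf t)" if s: "exp_integrable s" for s
  proof (cases "s \<le> u")
    case True
    then have "s * z \<le> u * z" using zy assms by (intro mult_right_mono) auto
    then show ?thesis using log_mgf_nonneg[OF s] by linarith
  next
    case False
    define l where "l = (u - t) / (s - t)"
    have l: "0 < l" "l \<le> 1" using assms False by (auto simp: l_def)
    have ls: "l * (s - t) = u - t" using assms False by (simp add: l_def)
    then have "(1 - l) * t + l * s = u" by (simp add: algebra_simps)
    with log_mgf_convex(2)[OF T(1) s, of l] l
    have "log_mgf u \<le> (1 - l) * log_mgf t + l * log_mgf s" by simp
    then have "z * (u - t) \<le> l * (log_mgf s - log_mgf t)"
      using chord by (simp add: algebra_simps)
    then have "l * (z * (s - t)) \<le> l * (log_mgf s - log_mgf t)"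
      unfolding ls[symmetric] by (simp add: mult.left_commute)
    then have "z * (s - t) \<le> log_mgf s - log_mgf t" using l by simp
    then show ?thesis by (simp add: algebra_simps)
  qed
  then show ?thesis using zy cramer_le_iff by blast
qed

text \<open>
  A transform that is finite somewhere to the right of \<open>y\<close> is right-continuous at \<open>y\<close> by convexity.
  If its value at \<open>y\<close> were below the level, it would stay below a little further, contradicting the
  choice of \<open>y\<close> as the infimum of the points where the level is reached.
\<close>

lemma level_le_cramer_at_cramer_inv:
  assumes "cramer_inv M X x = ereal y" "cramer M X y = ereal a" "0 \<le> y"
    and "y < z" "cramer M X z \<le> ereal b"
  shows "x \<le> a"
proof (rule ccontr)
  assume "\<not> x \<le> a"
  \<comment> \<open>The weight is so small that the chord value \<open>(1 - l) * a + l * b\<close> exceeds \<open>a\<close> by less than \<open>x - a\<close>.\<close>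
  define d where "d = \<bar>b - a\<bar> + 1"
  have d: "0 < d" by (simp add: d_def)
  define l where "l = min 1 ((x - a) / (2 * d))"
  have l: "0 < l" "l \<le> 1" using \<open>\<not> x \<le> a\<close> d by (auto simp: l_def)
  have "l * d \<le> (x - a) / (2 * d) * d"
    using d by (intro mult_right_mono) (auto simp: l_def)
  also have "\<dots> = (x - a) / 2" using d by (simp add: field_simps)
  finally have "l * \<bar>b - a\<bar> + l \<le> (x - a) / 2" by (simp add: d_def algebra_simps)
  moreover have "l * (b - a) \<le> l * \<bar>b - a\<bar>" using l by (intro mult_left_mono) auto
  ultimately have lx: "(1 - l) * a + l * b < x"
    using l \<open>\<not> x \<le> a\<close> by (simp add: algebra_simps)
  define w where "w = (1 - l) * y + l * z"
  have "l * y < l * z" using l assms by simp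
  then have w: "y < w" by (simp add: w_def algebra_simps)
  have "cramer M X w \<le> ereal ((1 - l) * a + l * b)"
    unfolding w_def using assms l by (intro cramer_convex) auto
  also have "\<dots> < ereal x" using lx by simp
  finally have wx: "cramer M X w < ereal x" .
  from w assms(1) have "cramer_inv M X x < ereal w" by simp
  then obtain y' where "0 < y'" "ereal x \<le> cramer M X y'" "y' < w"
    unfolding cramer_inv_def Inf_less_iff by auto
  with cramer_mono[of y' w] wx show False by auto
qed

section \<open>Feasible pairs and tangency\<close>

text \<open>
  Without denominators the conditions are affine in \<open>(v, c)\<close> jointly. Quantifying over all \<open>t > 0\<close>
  adds no constraint, since for \<open>c * t \<ge> 1\<close> they hold by the signs of their two sides; it makes the
  range of \<open>t\<close> independent of \<open>c\<close>.
\<close>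

lemma feasible_iff:
  assumes "0 \<le> c" "0 \<le> v"
  shows "feasible M X v c \<longleftrightarrow>
    (\<forall>t>0. (\<not> exp_integrable t \<longrightarrow> 1 \<le> c * t) \<and>
           (exp_integrable t \<longrightarrow> 2 * log_mgf t * (1 - c * t) \<le> v * t\<^sup>2))"
    (is "_ \<longleftrightarrow> (\<forall>t>0. ?P t)")
proof -
  have "(ereal t < 1 / ereal c \<longrightarrow> cgf M X t \<le> ereal (subgamma v c t)) \<longleftrightarrow> ?P t"
    if t: "0 < t" for t
  proof (cases "c * t < 1")
    case True
    then have "ereal t < 1 / ereal c" using less_inverse_ereal_iff assms t by simp
    moreover have "log_mgf t \<le> subgamma v c t \<longleftrightarrow> 2 * log_mgf t * (1 - c * t) \<le> v * t\<^sup>2"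
      unfolding subgamma_def
      by (subst pos_le_divide_eq) (use True in \<open>auto simp: algebra_simps\<close>)
    ultimately show ?thesis using True by (auto simp: cgf_eq)
  next
    case False
    then have "\<not> ereal t < 1 / ereal c" using less_inverse_ereal_iff assms t by simp
    moreover have "2 * log_mgf t * (1 - c * t) \<le> v * t\<^sup>2" if "exp_integrable t"
    proof -
      have "2 * log_mgf t * (1 - c * t) \<le> 0"
        using False log_mgf_nonneg[OF that] by (intro mult_nonneg_nonpos) auto
      also have "0 \<le> v * t\<^sup>2" using assms by simp
      finally show ?thesis .
    qed
    ultimately show ?thesis using False by auto
  qed
  moreover have "cgf M X 0 \<le> ereal (subgamma v c 0)"
    by (simp add: cgf_eq exp_integrable_0 log_mgf_0 subgamma_def)
  ultimately show ?thesis
    unfolding feasible_def by (metis less_eq_real_def)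
qed

lemma feasible_integrable:
  assumes "feasible M X v c" "0 \<le> c" "0 \<le> t" "c * t < 1"
  shows "exp_integrable t" "log_mgf t \<le> subgamma v c t"
proof -
  have "cgf M X t \<le> ereal (subgamma v c t)"
    using assms less_inverse_ereal_iff unfolding feasible_def by simp
  then show "exp_integrable t" "log_mgf t \<le> subgamma v c t"
    by (auto simp: cgf_eq split: if_splits)
qed

text \<open>
  A convex function that touches a differentiable majorant is supported by the tangent of the
  majorant. Indeed \<open>t\<close> is a convex combination of \<open>s\<close> and the reflected point \<open>t - h * (s - t)\<close>, where
  the majorant applies; the resulting lower bound on \<open>log_mgf s\<close> becomes the claim as \<open>h\<close> decreases
  to \<open>0\<close>.
\<close>

lemma tangent_line:
  assumes feas: "feasible M X v c" and c: "0 \<le> c" and t: "0 < t" "c * t < 1"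
    and touch: "log_mgf t = subgamma v c t" and s: "exp_integrable s"
  shows "log_mgf t + subgamma_slope v c t * (s - t) \<le> log_mgf s"
proof -
  let ?g = "subgamma v c"
  let ?p = "\<lambda>h. t - h * (s - t)"
  have "(?p has_real_derivative - (s - t)) (at 0)"
    by (auto intro!: derivative_eq_intros)
  then have "((\<lambda>h. ?g (?p h)) has_real_derivative subgamma_slope v c t * - (s - t)) (at 0)"
    by (rule DERIV_chain2[rotated]) (use subgamma_has_derivative[OF t(2)] in simp)
  then have "((\<lambda>h. (?g (?p h) - ?g t) / h) \<longlongrightarrow> subgamma_slope v c t * - (s - t)) (at_right 0)"
    by (auto simp: has_field_derivative_iff intro: tendsto_mono[OF at_le])
  moreover have "\<forall>\<^sub>F h in at_right 0. - (log_mgf s - log_mgf t) \<le> (?g (?p h) - ?g t) / h"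
  proof -
    have "((\<lambda>h. ?p h) \<longlongrightarrow> t) (at_right 0)" "((\<lambda>h. c * ?p h) \<longlongrightarrow> c * t) (at_right 0)"
      by (auto intro!: tendsto_eq_intros)
    then have "\<forall>\<^sub>F h in at_right 0. 0 < ?p h" "\<forall>\<^sub>F h in at_right 0. c * ?p h < 1"
      using t order_tendstoD by blast+
    moreover have "\<forall>\<^sub>F h in at_right 0. (0::real) < h"
      by (simp add: eventually_at_right_less)
    ultimately show ?thesis
    proof eventually_elim
      case (elim h)
      have p: "exp_integrable (?p h)" "log_mgf (?p h) \<le> ?g (?p h)"
        using feasible_integrable[OF feas c] elim by auto
      \<comment> \<open>With this weight, \<open>t\<close> is the combination of \<open>?p h\<close> and \<open>s\<close>.\<close>
      define l where "l = h / (1 + h)"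
      have l: "0 \<le> l" "l \<le> 1" "1 - l = 1 / (1 + h)" using elim by (auto simp: l_def field_simps)
      have "(1 - l) * ?p h + l * s = (?p h + h * s) / (1 + h)"
        unfolding l(3) unfolding l_def by (simp add: add_divide_distrib)
      also have "\<dots> = t" using elim by (simp add: field_simps)
      finally have "log_mgf t \<le> (1 - l) * log_mgf (?p h) + l * log_mgf s"
        using log_mgf_convex(2)[OF p(1) s l(1,2)] by simp
      also have "\<dots> = (log_mgf (?p h) + h * log_mgf s) / (1 + h)"
        unfolding l(3) unfolding l_def by (simp add: add_divide_distrib)
      finally have "log_mgf t * (1 + h) \<le> log_mgf (?p h) + h * log_mgf s"
        using elim by (simp add: pos_le_divide_eq)
      with p(2) touch have "- (log_mgf s - log_mgf t) * h \<le> ?g (?p h) - ?g t"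
        by (simp add: algebra_simps)
      then show ?case using elim by (simp add: pos_le_divide_eq)
    qed
  qed
  ultimately have "- (log_mgf s - log_mgf t) \<le> subgamma_slope v c t * - (s - t)"
    by (rule tendsto_lowerbound) simp
  then show ?thesis by (simp add: algebra_simps)
qed

text \<open>
  A supporting line of \<open>log_mgf\<close> at a contact point also supports the majorant near \<open>t\<close>, so the
  majorant minus the line has a local minimum at \<open>t\<close>.
\<close>

lemma supporting_slope_unique:
  assumes feas: "feasible M X v c" and c: "0 \<le> c" and t: "0 < t" "c * t < 1"
    and touch: "log_mgf t = subgamma v c t"
    and line: "\<And>s. exp_integrable s \<Longrightarrow> log_mgf t + y * (s - t) \<le> log_mgf s"
  shows "y = subgamma_slope v c t"
proof -
  have D: "((\<lambda>s. subgamma v c s - y * s) has_real_derivative subgamma_slope v c t - y) (at t)"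
    by (auto intro!: derivative_eq_intros subgamma_has_derivative t)
  have id: "((\<lambda>s. s) \<longlongrightarrow> t) (nhds t)" by (rule filterlim_ident)
  then have "((\<lambda>s. c * s) \<longlongrightarrow> c * t) (nhds t)" by (intro tendsto_intros)
  with id have "\<forall>\<^sub>F s in nhds t. 0 < s" "\<forall>\<^sub>F s in nhds t. c * s < 1"
    using t order_tendstoD by blast+
  then have "\<forall>\<^sub>F s in nhds t. subgamma v c t - y * t \<le> subgamma v c s - y * s"
  proof eventually_elim
    case (elim s)
    then have "exp_integrable s" "log_mgf s \<le> subgamma v c s"
      using feasible_integrable[OF feas c] by auto
    with line touch show ?case by (force simp: algebra_simps)
  qed
  then obtain d where "0 < d" "\<forall>s. \<bar>t - s\<bar> < d \<longrightarrow> subgamma v c t - y * t \<le> subgamma v c s - y * s"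
    unfolding eventually_nhds_metric dist_real_def by (metis abs_minus_commute)
  from DERIV_local_min[OF D this] show ?thesis by simp
qed

text \<open>
  Near a contact point the cumulant function is squeezed between the tangent and the majorant, which
  have the same derivative there.
\<close>

lemma cgf_deriv_tangency:
  assumes feas: "feasible M X v c" and c: "0 \<le> c" and t: "0 < t" "c * t < 1"
    and touch: "log_mgf t = subgamma v c t"
  shows "cgf_deriv M X t = subgamma_slope v c t"
proof -
  let ?y = "subgamma_slope v c t" and ?g = "subgamma v c"
  let ?k = "\<lambda>s. real_of_ereal (cgf M X s)"
  have ev: "\<forall>\<^sub>F s in at t. 0 < s" "\<forall>\<^sub>F s in at t. c * s < 1"
    using t by (auto intro!: order_tendstoD tendsto_eq_intros)
  have kt: "?k t = ?g t"
    using feasible_integrable[OF feas c _ t(2)] t touch by (simp add: cgf_eq)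
  have "((\<lambda>s. (?g s - ?g t) / (s - t) - ?y) \<longlongrightarrow> ?y - ?y) (at t)"
    using subgamma_has_derivative[OF t(2)]
    by (intro tendsto_diff tendsto_const) (simp add: has_field_derivative_iff)
  then have g0: "((\<lambda>s. \<bar>(?g s - ?g t) / (s - t) - ?y\<bar>) \<longlongrightarrow> 0) (at t)"
    by (simp add: tendsto_rabs_zero_iff)
  have "((\<lambda>s. (?k s - ?k t) / (s - t) - ?y) \<longlongrightarrow> 0) (at t)"
  proof (rule Lim_null_comparison[OF _ g0])
    have ne: "\<forall>\<^sub>F s in at t. s \<noteq> t" by (simp add: eventually_at_filter)
    show "\<forall>\<^sub>F s in at t. norm ((?k s - ?k t) / (s - t) - ?y) \<le> \<bar>(?g s - ?g t) / (s - t) - ?y\<bar>"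
      using ev ne
    proof eventually_elim
      case (elim s)
      have s: "exp_integrable s" "log_mgf s \<le> ?g s"
        using feasible_integrable[OF feas c] elim by auto
      have l: "?g t + ?y * (s - t) \<le> log_mgf s"
        using tangent_line[OF feas c t touch s(1)] touch by simp
      have *: "a / (s - t) - ?y = (a - ?y * (s - t)) / (s - t)" for a
        using elim by (simp add: field_simps)
      have "?k s = log_mgf s" using s by (simp add: cgf_eq)
      then show ?case
        unfolding kt * real_norm_def abs_divide using s l
        by (intro divide_right_mono) auto
    qed
  qed
  then have "(?k has_real_derivative ?y) (at t)"
    by (simp add: has_field_derivative_iff LIM_zero_iff)
  then show ?thesis unfolding cgf_deriv_def by (rule DERIV_imp_deriv)
qed

lemma feasible_mono:
  assumes "feasible M X v c" "0 \<le> c" "0 \<le> v" "c \<le> c'" "v \<le> v'"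
  shows "feasible M X v' c'"
proof -
  have "1 \<le> c' * t" if "0 < t" "1 \<le> c * t" for t
    using that assms mult_right_mono[of c c' t] by linarith
  moreover have "2 * log_mgf t * (1 - c' * t) \<le> v' * t\<^sup>2"
    if "0 < t" "exp_integrable t" "2 * log_mgf t * (1 - c * t) \<le> v * t\<^sup>2" for t
  proof -
    have "2 * log_mgf t * (1 - c' * t) \<le> 2 * log_mgf t * (1 - c * t)"
      using that assms log_mgf_nonneg by (intro mult_left_mono) auto
    also note that(3)
    also have "v * t\<^sup>2 \<le> v' * t\<^sup>2" using assms by (intro mult_right_mono) auto
    finally show ?thesis .
  qed
  ultimately show ?thesis
    using assms feasible_iff[of c v] feasible_iff[of c' v'] by auto
qed

lemma feasible_convex:
  assumes "feasible M X v c" "feasible M X v' c'" "0 \<le> c" "0 \<le> c'" "0 \<le> v" "0 \<le> v'"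
    and "0 \<le> l" "0 \<le> m" "l + m = 1"
  shows "feasible M X (l * v + m * v') (l * c + m * c')"
proof -
  have 1: "1 \<le> (l * c + m * c') * t" if "1 \<le> c * t" "1 \<le> c' * t" for t
  proof -
    have "l * 1 + m * 1 \<le> l * (c * t) + m * (c' * t)"
      using that assms by (intro add_mono mult_left_mono) auto
    with assms(9) show ?thesis by (simp add: algebra_simps)
  qed
  have 2: "k * (1 - (l * c + m * c') * t) \<le> (l * v + m * v') * t\<^sup>2"
    if "k * (1 - c * t) \<le> v * t\<^sup>2" "k * (1 - c' * t) \<le> v' * t\<^sup>2" for k t
  proof -
    have "l * (k * (1 - c * t)) + m * (k * (1 - c' * t)) \<le> l * (v * t\<^sup>2) + m * (v' * t\<^sup>2)"
      using that assms by (intro add_mono mult_left_mono) auto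
    moreover have "k * (1 - (l * c + m * c') * t)
        = k * (l + m - (l * c + m * c') * t)" using assms by simp
    ultimately show ?thesis by (simp add: algebra_simps)
  qed
  have "0 \<le> l * c + m * c'" "0 \<le> l * v + m * v'" using assms by simp_all
  then show ?thesis
    using assms(1-6) feasible_iff[of c v] feasible_iff[of c' v']
    by (subst feasible_iff) (auto intro!: 1 2)
qed


lemma variance_eq: "variance X = expectation (\<lambda>\<omega>. (X \<omega>)\<^sup>2)"
  by (simp add: centered)

end

section \<open>The least feasible scale\<close>

locale centered_exponential_moment = centered_variable +
  assumes tau_pos: "tau M X > 0"
begin

lemma exp_integrable_pos: "\<exists>t>0. exp_integrable t"
  using tau_pos unfolding tau_def less_Sup_iff by (auto simp: cgf_eq split: if_splits)

text \<open>
  Taking expectations in the cubic majorant of the exponential gives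
  \<open>2 * log_mgf t \<le> t\<^sup>2 * (V + 2 * C * t)\<close> for \<open>t \<le> t\<^sub>0 / 2\<close>. After multiplication by \<open>1 - c * t\<close> the
  cubic term is compensated as soon as \<open>c * V \<ge> 2 * C\<close>.
\<close>

lemma feasible_at_variance: "\<exists>c\<ge>0. feasible M X (variance X) c"
proof -
  obtain t\<^sub>0 where t0: "0 < t\<^sub>0" "exp_integrable t\<^sub>0" using exp_integrable_pos by blast
  let ?V = "variance X"
  define C where "C = 36 / t\<^sub>0 ^ 3 * expectation (\<lambda>\<omega>. exp (t\<^sub>0 * X \<omega>))"
  have C: "0 \<le> C" using t0 mgf_ge_1[OF t0(2)] by (simp add: C_def)
  \<comment> \<open>The first entry confines the range \<open>c * t < 1\<close> to \<open>t \<le> t\<^sub>0 / 2\<close>, the second one absorbs the cubic term.\<close>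
  define c where "c = max (2 / t\<^sub>0) (2 * C / ?V)"
  have c: "0 < c" "2 * C \<le> c * ?V" "2 / t\<^sub>0 \<le> c"
    using t0 C variance_pos by (auto simp: c_def pos_divide_le_eq[symmetric] less_max_iff_disj)
  have "exp_integrable t \<and> 2 * log_mgf t * (1 - c * t) \<le> ?V * t\<^sup>2" if t: "0 < t" "c * t < 1" for t
  proof
    have "2 / t\<^sub>0 * t \<le> c * t" using c t by (intro mult_right_mono) auto
    then have "2 / t\<^sub>0 * t < 1" using t by linarith
    then have tt: "t \<le> t\<^sub>0 / 2" using t0 by (simp add: field_simps)
    define l where "l = t / t\<^sub>0"
    have "0 \<le> l" "l \<le> 1" "(1 - l) * 0 + l * t\<^sub>0 = t" using tt t t0 by (auto simp: l_def)
    then show it: "exp_integrable t"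
      using log_mgf_convex(1)[OF exp_integrable_0 t0(2), of l] by simp
    have "log_mgf t \<le> expectation (\<lambda>\<omega>. exp (t * X \<omega>)) - 1"
      unfolding log_mgf_def using mgf_ge_1[OF it] by (intro ln_le_minus_one) auto
    also have "expectation (\<lambda>\<omega>. exp (t * X \<omega>)) \<le> expectation (\<lambda>\<omega>. 1 + t * X \<omega> + t\<^sup>2 / 2 * (X \<omega>)\<^sup>2
        + t ^ 3 * (36 / t\<^sub>0 ^ 3 * exp (t\<^sub>0 * X \<omega>)))"
      using it t0 t tt integrable_X integrable_square
      by (intro integral_mono exp_scaled_le_quadratic_plus_cubic) (auto simp: exp_integrable_def)
    also have "\<dots> = 1 + t\<^sup>2 / 2 * ?V + t ^ 3 * C"
      using t0 integrable_X integrable_square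
      by (simp add: exp_integrable_def prob_space variance_eq C_def centered)
    finally have k: "2 * log_mgf t \<le> t\<^sup>2 * (?V + 2 * C * t)"
      by (simp add: algebra_simps eval_nat_numeral)
    have "2 * log_mgf t * (1 - c * t) \<le> t\<^sup>2 * (?V + 2 * C * t) * (1 - c * t)"
      using k t by (intro mult_right_mono) auto
    also have "\<dots> = t\<^sup>2 * (?V - t * (c * ?V - 2 * C) - 2 * (C * c) * t\<^sup>2)"
      by (simp add: algebra_simps power2_eq_square)
    also have "\<dots> \<le> t\<^sup>2 * ?V"
    proof (intro mult_left_mono)
      have "0 \<le> t * (c * ?V - 2 * C)" "0 \<le> 2 * (C * c) * t\<^sup>2"
        using c C t by (auto intro!: mult_nonneg_nonneg)
      then show "?V - t * (c * ?V - 2 * C) - 2 * (C * c) * t\<^sup>2 \<le> ?V" by linarith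
    qed simp
    finally show "2 * log_mgf t * (1 - c * t) \<le> ?V * t\<^sup>2" by (simp add: mult.commute)
  qed
  moreover have "2 * log_mgf t * (1 - c * t) \<le> ?V * t\<^sup>2" if "exp_integrable t" "\<not> c * t < 1" for t
  proof -
    have "2 * log_mgf t * (1 - c * t) \<le> 0"
      using log_mgf_nonneg[OF that(1)] that by (intro mult_nonneg_nonpos) auto
    also have "0 \<le> ?V * t\<^sup>2" using variance_pos by (intro mult_nonneg_nonneg) auto
    finally show ?thesis .
  qed
  ultimately have "\<forall>t>0. (\<not> exp_integrable t \<longrightarrow> 1 \<le> c * t) \<and>
           (exp_integrable t \<longrightarrow> 2 * log_mgf t * (1 - c * t) \<le> ?V * t\<^sup>2)"
    by (meson not_le)
  then have "feasible M X ?V c"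
    using c variance_pos by (subst feasible_iff) auto
  then show ?thesis using c by (intro exI[of _ c]) auto
qed

definition c_min :: "real \<Rightarrow> real" where
  "c_min v = Inf {c. 0 \<le> c \<and> feasible M X v c}"

text \<open>
  The feasible scales form a nonempty upward closed set, which is closed because it is cut out by
  weak affine inequalities in \<open>c\<close>; so it is the ray starting at its infimum.
\<close>

lemma feasible_iff_c_min_le:
  assumes "variance X \<le> v"
  shows "0 \<le> c \<and> feasible M X v c \<longleftrightarrow> c_min v \<le> c"
proof -
  let ?S = "{c. 0 \<le> c \<and> feasible M X v c}"
  have v: "0 \<le> v" using assms variance_pos by linarith
  obtain c\<^sub>0 where c0: "0 \<le> c\<^sub>0" "feasible M X (variance X) c\<^sub>0"
    using feasible_at_variance by blast
  then have "c\<^sub>0 \<in> ?S" using feasible_mono[OF c0(2,1), of c\<^sub>0 v] assms variance_pos by simp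
  then have ne: "?S \<noteq> {}" by blast
  have bd: "bdd_below ?S" by (intro bdd_belowI[of _ 0]) auto
  have "?S = {0..} \<inter> (\<Inter>t\<in>{0<..}. {c. \<not> exp_integrable t \<longrightarrow> 1 \<le> c * t} \<inter>
           {c. exp_integrable t \<longrightarrow> 2 * log_mgf t * (1 - c * t) \<le> v * t\<^sup>2})"
    using feasible_iff[OF _ v] by auto
  also have "closed \<dots>"
    by (intro closed_Int closed_INT ballI closed_Collect_imp closed_Collect_le)
       (auto intro!: continuous_intros)
  finally have "c_min v \<in> ?S"
    unfolding c_min_def using ne bd by (intro closed_contains_Inf)
  moreover have "c_min v \<le> c" if "c \<in> ?S"
    unfolding c_min_def using that bd by (rule cInf_lower)
  ultimately show ?thesis using feasible_mono[of v "c_min v" c v] v by auto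
qed

lemma c_min_nonneg: "variance X \<le> v \<Longrightarrow> 0 \<le> c_min v"
  and feasible_c_min: "variance X \<le> v \<Longrightarrow> feasible M X v (c_min v)"
  using feasible_iff_c_min_le[of v "c_min v"] by auto

lemma c_star_eq:
  assumes "variance X \<le> v"
  shows "c_star M X v = ereal (c_min v)"
  unfolding c_star_def using feasible_iff_c_min_le[OF assms]
  by (intro antisym Inf_lower Inf_greatest) auto

lemma c_min_antimono:
  assumes "variance X \<le> v" "v \<le> w"
  shows "c_min w \<le> c_min v"
proof -
  have "feasible M X w (c_min v)"
    using feasible_mono[OF feasible_c_min c_min_nonneg] assms variance_pos by simp
  then show ?thesis
    using feasible_iff_c_min_le[of w "c_min v"] c_min_nonneg assms by simp
qed

lemma c_min_convex: "convex_on {variance X..} c_min"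
proof (rule convex_onI)
  fix l v w :: real
  assume l: "0 < l" "l < 1" and "v \<in> {variance X..}" "w \<in> {variance X..}"
  then have vw: "variance X \<le> v" "variance X \<le> w" "0 \<le> v" "0 \<le> w"
    using variance_pos by auto
  have "(1 - l) * variance X + l * variance X \<le> (1 - l) * v + l * w"
    using l vw by (intro add_mono mult_left_mono) auto
  then have m: "variance X \<le> (1 - l) * v + l * w" by (simp add: algebra_simps)
  have "feasible M X ((1 - l) * v + l * w) ((1 - l) * c_min v + l * c_min w)"
    using l vw feasible_c_min c_min_nonneg by (intro feasible_convex) auto
  moreover have "0 \<le> (1 - l) * c_min v + l * c_min w"
    using l vw c_min_nonneg by simp
  ultimately show "c_min ((1 - l) *\<^sub>R v + l *\<^sub>R w) \<le> (1 - l) * c_min v + l * c_min w"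
    using feasible_iff_c_min_le[OF m, of "(1 - l) * c_min v + l * c_min w"] by simp
qed simp

text \<open>
  Convexity gives continuity in the interior only. At the end point monotonicity is upper
  semicontinuity; lower semicontinuity holds because a scale \<open>a\<close> infeasible for \<open>V\<close> violates one of
  the affine conditions strictly, and this persists for nearby \<open>v\<close>.
\<close>

lemma c_min_continuous: "continuous_on {variance X..} c_min"
proof -
  let ?V = "variance X"
  have "convex_on {?V<..} c_min"
    using c_min_convex by (rule convex_on_subset) auto
  then have "continuous_on {?V<..} c_min"
    by (intro convex_on_continuous) auto
  then have interior: "continuous (at v within {?V..}) c_min" if "?V < v" for v
    using that by (simp add: continuous_on_eq_continuous_at continuous_at_imp_continuous_at_within)
  have "(c_min \<longlongrightarrow> c_min ?V) (at ?V within {?V..})"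
  proof (rule order_tendstoI)
    fix a assume a: "c_min ?V < a"
    show "\<forall>\<^sub>F v in at ?V within {?V..}. c_min v < a"
      unfolding eventually_at_filter
      by (rule always_eventually) (use c_min_antimono[of ?V] a in force)
  next
    fix a assume a: "a < c_min ?V"
    have "\<forall>\<^sub>F v in at ?V within {?V..}. ?V \<le> v \<and> \<not> (0 \<le> a \<and> feasible M X v a)"
    proof (cases "0 \<le> a")
      case False
      then show ?thesis by (simp add: eventually_at_filter)
    next
      case True
      then have "\<not> feasible M X ?V a" using feasible_iff_c_min_le[of ?V a] a by auto
      then obtain t where t: "0 < t" and *: "(\<not> exp_integrable t \<and> a * t < 1) \<or>
          (exp_integrable t \<and> ?V * t\<^sup>2 < 2 * log_mgf t * (1 - a * t))"
        using feasible_iff[of a ?V] True variance_pos by (meson less_imp_le not_le)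
      have "((\<lambda>v. v * t\<^sup>2) \<longlongrightarrow> ?V * t\<^sup>2) (at ?V within {?V..})"
        by (intro tendsto_intros)
      then have "\<forall>\<^sub>F v in at ?V within {?V..}. (\<not> exp_integrable t \<and> a * t < 1) \<or>
          (exp_integrable t \<and> v * t\<^sup>2 < 2 * log_mgf t * (1 - a * t))"
        using * by (auto dest: order_tendstoD)
      moreover have "\<forall>\<^sub>F v in at ?V within {?V..}. ?V \<le> v"
        by (simp add: eventually_at_filter)
      ultimately show ?thesis
      proof eventually_elim
        case (elim v)
        then show ?case using feasible_iff[of a v] t True variance_pos by force
      qed
    qed
    then show "\<forall>\<^sub>F v in at ?V within {?V..}. a < c_min v"
      by eventually_elim (use feasible_iff_c_min_le in force)
  qed
  with interior show ?thesis
    unfolding continuous_on_eq_continuous_within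
    by (metis atLeast_iff continuous_within order_le_less)
qed

section \<open>Exactness of the optimised bound\<close>

lemma bound_eq:
  assumes "variance X \<le> v"
  shows "bound M X x v = ereal (sqrt (2 * v * x) + c_min v * x)"
  by (simp add: bound_def c_star_eq[OF assms])

lemma bound_continuous: "continuous_on {variance X..} (bound M X x)"
proof -
  have "continuous_on {variance X..} (\<lambda>v. ereal (sqrt (2 * v * x) + c_min v * x))"
    by (intro continuous_intros c_min_continuous)
  then show ?thesis
    by (rule continuous_on_cong[THEN iffD1, rotated -1]) (auto simp: bound_eq)
qed

lemma bound_ge_sqrt:
  assumes "variance X \<le> v" "0 \<le> x"
  shows "ereal (sqrt (2 * v * x)) \<le> bound M X x v"
  using assms c_min_nonneg by (simp add: bound_eq)

lemma bound_tendsto_infinity: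
  assumes "0 < x"
  shows "(bound M X x \<longlongrightarrow> \<infinity>) at_top"
proof -
  have "filterlim (\<lambda>v. v * (2 * x)) at_top at_top"
    using assms by (intro filterlim_at_top_mult_tendsto_pos[OF tendsto_const])
      (auto intro: filterlim_ident)
  then have "filterlim (\<lambda>v. sqrt (2 * v * x)) at_top at_top"
    by (intro filterlim_compose[OF sqrt_at_top]) (simp add: mult_ac)
  then have "((\<lambda>v. ereal (sqrt (2 * v * x))) \<longlongrightarrow> \<infinity>) at_top"
    by (simp add: tendsto_PInfty_eq_at_top)
  moreover have "\<forall>\<^sub>F v in at_top. ereal (sqrt (2 * v * x)) \<le> bound M X x v"
    using eventually_ge_at_top[of "variance X"]
    by eventually_elim (use assms in \<open>simp add: bound_ge_sqrt\<close>)
  ultimately show ?thesis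
    using tendsto_sandwich[OF _ _ _ tendsto_const] by fastforce
qed

lemma y_star_attained:
  assumes "0 < x"
  shows "\<exists>v\<ge>variance X. y_star M X x = bound M X x v"
proof -
  let ?V = "variance X"
  \<comment> \<open>Beyond \<open>B\<close> the term \<open>sqrt (2 * v * x)\<close> alone exceeds the value of the bound at \<open>?V\<close>.\<close>
  define B where "B = max ?V ((real_of_ereal (bound M X x ?V))\<^sup>2 / (2 * x))"
  have "continuous_on {?V..B} (bound M X x)"
    by (rule continuous_on_subset[OF bound_continuous]) auto
  then obtain v where v: "v \<in> {?V..B}" "\<forall>w\<in>{?V..B}. bound M X x v \<le> bound M X x w"
    using continuous_attains_inf[of "{?V..B}" "bound M X x"] by (auto simp: B_def)
  have "bound M X x v \<le> bound M X x w" if w: "?V \<le> w" for w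
  proof (cases "w \<le> B")
    case True
    then show ?thesis using v w by simp
  next
    case False
    have "bound M X x v \<le> bound M X x ?V" using v by (auto simp: B_def)
    also have "\<dots> \<le> ereal (sqrt (2 * w * x))"
    proof -
      have "(real_of_ereal (bound M X x ?V))\<^sup>2 / (2 * x) \<le> w" using False by (simp add: B_def)
      then have "(real_of_ereal (bound M X x ?V))\<^sup>2 \<le> 2 * w * x"
        using assms by (simp add: field_simps)
      then have "real_of_ereal (bound M X x ?V) \<le> sqrt (2 * w * x)"
        by (rule real_le_rsqrt)
      then show ?thesis by (simp add: bound_eq)
    qed
    also have "\<dots> \<le> bound M X x w" using w assms by (intro bound_ge_sqrt) auto
    finally show ?thesis .
  qed
  then have "y_star M X x = bound M X x v"
    unfolding y_star_def using v by (intro antisym INF_greatest INF_lower) auto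
  then show ?thesis using v by auto
qed

text \<open>
  At this \<open>t\<close> the Chernoff exponent for deviation \<open>y\<close> is at least \<open>x\<close>, with equality exactly if
  \<open>log_mgf\<close> touches its majorant there. The point serves both the general inequality and the
  analysis of equality.
\<close>

lemma chernoff_point_of_bound:
  assumes "variance X \<le> v" "0 < x"
  obtains y t where "bound M X x v = ereal y" "0 < y" "0 < t" "c_min v * t < 1"
    "exp_integrable t" "log_mgf t \<le> subgamma v (c_min v) t" "t * y - subgamma v (c_min v) t = x"
proof -
  have v: "0 < v" using assms variance_pos by linarith
  obtain t where t: "0 < t" "c_min v * t < 1"
      "t * (sqrt (2 * v * x) + c_min v * x) - subgamma v (c_min v) t = x"
    using subgamma_conjugate_attained[OF c_min_nonneg[OF assms(1)] v assms(2)] by blast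
  have "0 < sqrt (2 * v * x) + c_min v * x"
    using v assms c_min_nonneg[OF assms(1)] by (intro add_pos_nonneg) auto
  with that[OF bound_eq[OF assms(1)] this t(1,2) _ _ t(3)] show ?thesis
    using feasible_integrable[OF feasible_c_min c_min_nonneg, of v t] assms t by simp
qed

lemma cramer_inv_le_bound:
  assumes "variance X \<le> v" "0 < x"
  shows "cramer_inv M X x \<le> bound M X x v"
proof -
  obtain y t where *: "bound M X x v = ereal y" "0 < y" "exp_integrable t"
    "log_mgf t \<le> subgamma v (c_min v) t" "t * y - subgamma v (c_min v) t = x"
    using chernoff_point_of_bound[OF assms] by metis
  have "ereal x \<le> ereal (t * y - log_mgf t)" using * by simp
  also have "\<dots> \<le> cramer M X y" using * by (intro ereal_le_cramer)
  finally show ?thesis using cramer_inv_le[OF *(2)] *(1) by simp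
qed

lemma cramer_inv_le_y_star: "0 < x \<Longrightarrow> cramer_inv M X x \<le> y_star M X x"
  unfolding y_star_def by (intro INF_greatest cramer_inv_le_bound) auto

text \<open>Finiteness of the cumulant function at \<open>t\<close> is implied by feasibility, so real values suffice.\<close>

lemma tangency_witness_iff:
  "tangency_witness M X v t \<longleftrightarrow> variance X \<le> v \<and> 0 < t \<and> c_min v * t < 1 \<and>
     log_mgf t = subgamma v (c_min v) t" (is "_ \<longleftrightarrow> ?R")
proof -
  have "tangency_witness M X v t \<longleftrightarrow> variance X \<le> v \<and> 0 < t \<and>
      c_min v * t < 1 \<and> cgf M X t = ereal (subgamma v (c_min v) t)"
    using c_min_nonneg[of v] less_inverse_ereal_iff[of "c_min v" t]
    by (auto simp: tangency_witness_def c_star_eq)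
  also have "\<dots> \<longleftrightarrow> ?R"
    using feasible_integrable[OF feasible_c_min c_min_nonneg, of v t]
    by (auto simp: cgf_eq)
  finally show ?thesis .
qed

text \<open>
  The tangent of the majorant supports \<open>log_mgf\<close> at \<open>t\<close>, so both functions have the same conjugate
  at the slope \<open>y\<close>; the formula for the inverse conjugate then evaluates the bound.
\<close>

lemma tangency_maximiser:
  assumes "tangency_witness M X v t"
  defines "y \<equiv> cgf_deriv M X t"
  obtains x where "0 < x" "0 < y" "legendre_maximiser M X y t" "cramer M X y = ereal x"
    "bound M X x v = ereal y"
proof
  let ?c = "c_min v"
  have v: "variance X \<le> v" "0 < v" and t: "0 < t" "?c * t < 1"
    and touch: "log_mgf t = subgamma v ?c t"
    using assms variance_pos unfolding tangency_witness_iff by auto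
  note feas = feasible_c_min[OF v(1)] c_min_nonneg[OF v(1)]
  have y: "y = subgamma_slope v ?c t"
    unfolding y_def by (rule cgf_deriv_tangency[OF feas t touch])
  have it: "exp_integrable t" using feasible_integrable(1)[OF feas] t by simp
  define x where "x = t * y - subgamma v ?c t"
  have "x = v * t\<^sup>2 / (2 * (1 - ?c * t)\<^sup>2)"
    unfolding x_def y by (rule subgamma_conjugate[OF t(2)])
  then show x: "0 < x" using v t by simp
  show cr: "cramer M X y = ereal x"
    unfolding x_def touch[symmetric]
  proof (rule legendre_maximiserI[OF it])
    fix s assume "exp_integrable s"
    from tangent_line[OF feas t touch this]
    show "s * y - log_mgf s \<le> t * y - log_mgf t"
      unfolding y by (simp add: algebra_simps)
  qed
  then show "legendre_maximiser M X y t"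
    unfolding legendre_maximiser_def x_def using it touch by (simp add: cgf_eq)
  have "sqrt (2 * v * x) + ?c * x = y"
    unfolding x_def y by (rule subgamma_inverse_conjugate[OF t(2,1) v(2)])
  then show b: "bound M X x v = ereal y" by (simp add: bound_eq[OF v(1)])
  have "0 < sqrt (2 * v * x) + ?c * x"
    using v x feas(2) by (intro add_pos_nonneg) auto
  then show "0 < y" using \<open>sqrt (2 * v * x) + ?c * x = y\<close> by simp
qed

lemma tangency_exact:
  assumes "tangency_witness M X v t"
  shows "\<exists>x>0. cramer M X (cgf_deriv M X t) = ereal x \<and>
          bound M X x v = ereal (cgf_deriv M X t) \<and>
          ereal (cgf_deriv M X t) = cramer_inv M X x \<and>
          y_star M X x = bound M X x v \<and>
          y_star M X x = cramer_inv M X x"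
proof -
  obtain x where x: "0 < x" "0 < cgf_deriv M X t" "cramer M X (cgf_deriv M X t) = ereal x"
    "bound M X x v = ereal (cgf_deriv M X t)"
    using tangency_maximiser[OF assms] by metis
  have inv: "cramer_inv M X x = ereal (cgf_deriv M X t)"
    using x by (intro cramer_inv_cramer)
  have "y_star M X x \<le> bound M X x v"
    unfolding y_star_def using assms by (intro INF_lower) (simp add: tangency_witness_iff)
  then show ?thesis
    using x inv cramer_inv_le_y_star[OF x(1)] by (intro exI[of _ x]) auto
qed

text \<open>
  At the optimal \<open>v\<close>, \<open>x = t * y - subgamma v (c_min v) t \<le> t * y - log_mgf t \<le> I y \<le> x\<close>, so all of
  these are equal.
\<close>

lemma exact_imp_maximiser_tangency:
  assumes "0 < x" "y_star M X x = cramer_inv M X x"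
  obtains y t where "cramer_inv M X x = ereal y" "legendre_maximiser M X y t"
    "t \<in> tangency_set M X"
proof -
  obtain v where v: "variance X \<le> v" "y_star M X x = bound M X x v"
    using y_star_attained[OF assms(1)] by blast
  obtain y t where *: "bound M X x v = ereal y" "0 < t" "c_min v * t < 1" "exp_integrable t"
    "log_mgf t \<le> subgamma v (c_min v) t" "t * y - subgamma v (c_min v) t = x"
    using chernoff_point_of_bound[OF v(1) assms(1)] by metis
  have inv: "cramer_inv M X x = ereal y" using * v assms by simp
  have le: "cramer M X y \<le> ereal x" by (rule cramer_at_cramer_inv_le[OF assms(1) inv])
  then have "t * y - log_mgf t \<le> x" using *(4) cramer_le_iff by blast
  then have eq: "log_mgf t = subgamma v (c_min v) t" using * by simp
  have "cramer M X y = ereal (t * y - log_mgf t)"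
    using le ereal_le_cramer[OF *(4), of y] *(6) eq by simp
  then have "legendre_maximiser M X y t"
    using *(4) by (simp add: legendre_maximiser_def cgf_eq)
  moreover have "t \<in> tangency_set M X"
    unfolding tangency_set_def tangency_witness_iff using v * eq by auto
  ultimately show ?thesis using that inv by blast
qed

text \<open>
  Exactness holds at the level \<open>a = I y\<close>. What remains is \<open>x = a\<close>: lower semicontinuity yields
  \<open>a \<le> x\<close>, and finiteness of the transform to the right of \<open>y\<close> yields \<open>x \<le> a\<close>.
\<close>

lemma maximiser_tangency_imp_exact:
  assumes "0 < x" "cramer_inv M X x = ereal y" "legendre_maximiser M X y t"
    "t \<in> tangency_set M X"
  shows "y_star M X x = cramer_inv M X x"
proof -
  obtain v where w: "tangency_witness M X v t" using assms by (auto simp: tangency_set_def)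
  let ?c = "c_min v"
  have v: "variance X \<le> v" and t: "0 < t" "?c * t < 1"
    and touch: "log_mgf t = subgamma v ?c t"
    using w unfolding tangency_witness_iff by auto
  note feas = feasible_c_min[OF v] c_min_nonneg[OF v]
  have "y = subgamma_slope v ?c t"
  proof (rule supporting_slope_unique[OF feas t touch])
    fix s assume "exp_integrable s"
    from legendre_maximiserD(3)[OF assms(3) this]
    show "log_mgf t + y * (s - t) \<le> log_mgf s" by (simp add: algebra_simps)
  qed
  then have y: "y = cgf_deriv M X t"
    using cgf_deriv_tangency[OF feas t touch] by simp
  obtain a where a: "0 < a" "cramer M X y = ereal a" "cramer_inv M X a = ereal y"
    "y_star M X a = cramer_inv M X a"
    using tangency_exact[OF w] unfolding y by metis
  have yp: "0 < y" using tangency_maximiser[OF w] unfolding y by metis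
  have "a \<le> x" using cramer_at_cramer_inv_le[OF assms(1,2)] a by simp
  moreover have "x \<le> a"
  proof -
    have "\<forall>\<^sub>F u in at_right t. ?c * u < 1"
      by (rule order_tendstoD[OF _ t(2)]) (auto intro!: tendsto_eq_intros)
    then have "\<forall>\<^sub>F u in at_right t. ?c * u < 1 \<and> t < u"
      using eventually_at_right_less[of t] by eventually_elim simp
    then obtain u where "?c * u < 1" "t < u"
      using eventually_happens[of _ "at_right t"] by auto
    then obtain z b where "y < z" "cramer M X z \<le> ereal b"
      using cramer_finite_right_of_maximiser[OF assms(3), of u]
        feasible_integrable(1)[OF feas, of u] yp t by auto
    then show ?thesis using level_le_cramer_at_cramer_inv assms(2) a(2) yp by (meson less_imp_le)
  qed
  ultimately have "x = a" by simp
  then show ?thesis using a by simp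
qed

end

section \<open>Comparison of the optimised bound with the Chernoff deviation\<close>

theorem theorem8p1:
  fixes M :: "'a measure" and X :: "'a \<Rightarrow> real"
  assumes "prob_space M"
    and "X \<in> borel_measurable M"
    and infdiv: "infinitely_divisible (distr M borel X)"
    and finite_variance: "integrable M (\<lambda>\<omega>. (X \<omega>)\<^sup>2)"
    and centered: "prob_space.expectation M X = 0"
    and nondegenerate: "\<not> (\<exists>b. AE \<omega> in M. X \<omega> = b)"
    and "prob_space.variance M X > 0"
    and "tau M X > 0"
  shows
    \<comment> \<open>(i)\<close>
    "(\<forall>x>0. y_star M X x \<ge> cramer_inv M X x) \<and>
    \<comment> \<open>(ii)\<close>
    (\<forall>v t. tangency_witness M X v t \<longrightarrow>
       (\<exists>x>0. cramer M X (cgf_deriv M X t) = ereal x \<and>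
          bound M X x v = ereal (cgf_deriv M X t) \<and>
          ereal (cgf_deriv M X t) = cramer_inv M X x \<and>
          y_star M X x = bound M X x v \<and>
          y_star M X x = cramer_inv M X x)) \<and>
    \<comment> \<open>(iii)\<close>
    (\<forall>l \<in> (\<lambda>t. cramer M X (cgf_deriv M X t)) ` tangency_set M X.
       \<exists>x>0. l = ereal x \<and> y_star M X x = cramer_inv M X x) \<and>
    \<comment> \<open>(iv)\<close>
    (\<forall>x>0. y_star M X x = cramer_inv M X x \<longrightarrow>
       (\<exists>y. cramer_inv M X x = ereal y \<and>
          (\<exists>t. legendre_maximiser M X y t) \<and>
          (\<forall>t. legendre_maximiser M X y t \<longrightarrow> t \<in> tangency_set M X))) \<and>
    (\<forall>x>0. y_star M X x = cramer_inv M X x \<longleftrightarrow>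
       (\<exists>y t. cramer_inv M X x = ereal y \<and>
          legendre_maximiser M X y t \<and> t \<in> tangency_set M X)) \<and>
    \<comment> \<open>attainment\<close>
    (\<forall>x>0.
       (\<exists>v\<ge>prob_space.variance M X. y_star M X x = bound M X x v) \<and>
       (\<forall>v\<ge>prob_space.variance M X. \<bar>bound M X x v\<bar> \<noteq> \<infinity>) \<and>
       continuous_on {prob_space.variance M X..} (bound M X x) \<and>
       ((bound M X x) \<longlongrightarrow> \<infinity>) at_top)"
proof -
  interpret prob_space M by fact
  interpret centered_exponential_moment M X
    by unfold_locales fact+
  have conv: "\<exists>y. cramer_inv M X x = ereal y \<and> (\<exists>t. legendre_maximiser M X y t) \<and>
      (\<forall>t. legendre_maximiser M X y t \<longrightarrow> t \<in> tangency_set M X)"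
    if "0 < x" "y_star M X x = cramer_inv M X x" for x
    using exact_imp_maximiser_tangency[OF that] legendre_maximiser_unique by metis
  show ?thesis
  proof (intro conjI allI ballI impI)
    fix l assume "l \<in> (\<lambda>t. cramer M X (cgf_deriv M X t)) ` tangency_set M X"
    then show "\<exists>x>0. l = ereal x \<and> y_star M X x = cramer_inv M X x"
      using tangency_exact by (fastforce simp: tangency_set_def)
  next
    fix x :: real assume "0 < x"
    then show "y_star M X x = cramer_inv M X x \<longleftrightarrow>
       (\<exists>y t. cramer_inv M X x = ereal y \<and> legendre_maximiser M X y t \<and> t \<in> tangency_set M X)"
      using conv maximiser_tangency_imp_exact by blast
  qed (auto simp: cramer_inv_le_y_star tangency_exact conv y_star_attained bound_eq
      bound_continuous bound_tendsto_infinity)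
qed

end
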